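(* Let $A$ be a $C^*$-algebra, and let $a, b\in A$ be regular elements such that $ab$ is also regular. Define $p = bb^{\dagger}$, $q = a^{\dagger}(a^{\dagger})^{*}$, $r = bb^*$ and $s = a^{\dagger}a$. Then the following statements are equivalent: (i) $(ab)^{\dagger} = b^{\dagger}a^{\dagger}$; (ii) $a(pq-qp)(b^{\dagger})^{*}=0$ and $a(rs-sr)(b^{\dagger})^{*}=0$; (iii) $spqp = qp$ and $srsp = sr$.
   Context: An element $a$ of a $C^*$-algebra $A$ is called regular if there is $a'\in A$ with $a = aa'a$. Every regular element $a$ of a $C^*$-algebra has a unique Moore-Penrose inverse, denoted $a^{\dagger}$: the unique $x\in A$ with $a=axa$, $x=xax$, $(ax)^*=ax$, $(xa)^*=xa$. *)

theory Defs
  imports "HOL-Analysis.Analysis"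
begin

(* A C*-algebra is not assumed to be unital.  The real structure inherited from
   real_normed_algebra is the restriction of the complex one (scaleR_scaleC). *)
class cstar_algebra = real_normed_algebra + complete_space +
  fixes scaleC :: "complex \<Rightarrow> 'a \<Rightarrow> 'a"
    and adjoint_elt :: "'a \<Rightarrow> 'a"  ("(_\<^sup>\<star>)" [1000] 999)
  assumes scaleR_scaleC: "scaleR c x = scaleC (complex_of_real c) x"
    and scaleC_add_right: "scaleC z (x + y) = scaleC z x + scaleC z y"
    and scaleC_add_left: "scaleC (z + w) x = scaleC z x + scaleC w x"
    and scaleC_scaleC: "scaleC z (scaleC w x) = scaleC (z * w) x"
    and scaleC_one: "scaleC 1 x = x"
    and mult_scaleC_left: "scaleC z x * y = scaleC z (x * y)"
    and mult_scaleC_right: "x * scaleC z y = scaleC z (x * y)"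
    and norm_scaleC: "norm (scaleC z x) = cmod z * norm x"
    and adjoint_elt_add: "(x + y)\<^sup>\<star> = x\<^sup>\<star> + y\<^sup>\<star>"
    and adjoint_elt_scaleC: "(scaleC z x)\<^sup>\<star> = scaleC (cnj z) (x\<^sup>\<star>)"
    and adjoint_elt_mult: "(x * y)\<^sup>\<star> = y\<^sup>\<star> * x\<^sup>\<star>"
    and adjoint_elt_adjoint_elt: "(x\<^sup>\<star>)\<^sup>\<star> = x"
    and cstar_identity: "norm (x\<^sup>\<star> * x) = (norm x)\<^sup>2"

instantiation complex :: cstar_algebra
begin

definition scaleC_complex :: "complex \<Rightarrow> complex \<Rightarrow> complex"
  where "scaleC_complex = (*)"

definition adjoint_elt_complex :: "complex \<Rightarrow> complex"
  where "adjoint_elt_complex = cnj"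

instance
  by standard
    (simp_all add: scaleC_complex_def adjoint_elt_complex_def scaleR_conv_of_real
      norm_mult power2_eq_square algebra_simps)

end

definition regular_elt :: "'a::cstar_algebra \<Rightarrow> bool"
  where "regular_elt a \<longleftrightarrow> (\<exists>a'. a = a * a' * a)"

definition is_mp_inverse :: "'a::cstar_algebra \<Rightarrow> 'a \<Rightarrow> bool"
  where "is_mp_inverse a x \<longleftrightarrow>
    a = a * x * a \<and> x = x * a * x \<and> (a * x)\<^sup>\<star> = a * x \<and> (x * a)\<^sup>\<star> = x * a"

(* Meaningful only for regular a, where the inverse exists and is unique. *)
definition mp_inverse :: "'a::cstar_algebra \<Rightarrow> 'a"  ("(_\<^sup>\<dagger>)" [1000] 999)
  where "a\<^sup>\<dagger> = (THE x. is_mp_inverse a x)"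

end

theory Submission
  imports Defs
begin

text \<open>
  Two things have to be shown: that the Moore-Penrose inverses in the statement exist, and that
  the three conditions are algebraically equivalent.

  For existence, let \<open>e = a * a'\<close> be the idempotent given by \<open>a = a * a' * a\<close>. The self-adjoint
  projection \<open>f\<close> with the same range as \<open>e\<close> is \<open>(1 + k)\<^sup>-\<^sup>1 * e\<^sup>\<star>\<close> with \<open>k = e\<^sup>\<star> - e\<close>, so all that is
  needed from analysis is that \<open>1 + k\<close> is invertible when \<open>k\<close> is skew-adjoint. This holds because
  \<open>1 + k = (1 + t) - (t - k)\<close> and the \<open>C\<^sup>*\<close> identity gives \<open>norm (t - k)\<^sup>2 \<le> t\<^sup>2 + (norm k)\<^sup>2\<close>,
  which is below \<open>(1 + t)\<^sup>2\<close> for large \<open>t\<close>. The algebra may lack a unit, so invertibility is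
  expressed as unique solvability of \<open>x + k * x = y\<close> and obtained from Banach's fixed point theorem
  (\<open>skew_adjoint_unique_solution\<close>). The projections for \<open>a\<close> and for \<open>a\<^sup>\<star>\<close> then cut an arbitrary
  inner inverse \<open>a'\<close> down to the Moore-Penrose inverse (\<open>regular_imp_mp_inverse\<close>).

  For the equivalence, each equation of (ii) turns into the corresponding equation of (iii) after
  multiplying by \<open>a\<^sup>\<dagger>\<close> on the left and by \<open>b\<^sup>\<star>\<close> on the right, and these multiplications are
  reversible. Each of (i) and (iii) makes \<open>s * p\<close> idempotent, and a product of two self-adjoint
  projections is idempotent only if they commute (\<open>projections_commute\<close>). Once \<open>s\<close> and \<open>p\<close>
  commute, the first two Penrose equations for \<open>b\<^sup>\<dagger> * a\<^sup>\<dagger>\<close> are automatic, while the other two say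
  that \<open>p\<close> commutes with \<open>q\<close> and \<open>s\<close> with \<open>r\<close>; that is (iii).
\<close>

section \<open>The involution\<close>

lemma adjoint_elt_zero [simp]: "(0::'a::cstar_algebra)\<^sup>\<star> = 0"
  using adjoint_elt_add[of "0::'a" 0] by simp

lemma adjoint_elt_minus: "(- x)\<^sup>\<star> = - ((x::'a::cstar_algebra)\<^sup>\<star>)"
  using adjoint_elt_add[of x "- x"] by (simp add: add_eq_0_iff)

lemma adjoint_elt_diff: "(x - y)\<^sup>\<star> = (x::'a::cstar_algebra)\<^sup>\<star> - y\<^sup>\<star>"
  using adjoint_elt_add[of x "- y"] by (simp add: adjoint_elt_minus)

lemma adjoint_elt_scaleR: "(c *\<^sub>R x)\<^sup>\<star> = c *\<^sub>R ((x::'a::cstar_algebra)\<^sup>\<star>)"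
  by (simp add: scaleR_scaleC adjoint_elt_scaleC)

lemma norm_adjoint_elt: "norm ((x::'a::cstar_algebra)\<^sup>\<star>) = norm x"
proof -
  have le: "norm y \<le> norm (y\<^sup>\<star>)" for y :: 'a
  proof (cases "norm y = 0")
    case False
    have "norm y * norm y \<le> norm (y\<^sup>\<star>) * norm y"
      using norm_mult_ineq[of "y\<^sup>\<star>" y] by (simp add: cstar_identity power2_eq_square)
    then show ?thesis using False by simp
  qed simp
  show ?thesis using le[of x] le[of "x\<^sup>\<star>"] by (simp add: adjoint_elt_adjoint_elt)
qed

lemma cstar_norm_eq_0: "(x::'a::cstar_algebra)\<^sup>\<star> * x = 0 \<Longrightarrow> x = 0"
  using cstar_identity[of x] by simp

text \<open>Writing \<open>u = s * p\<close>, one has \<open>(u - p * u)\<^sup>\<star> * (u - p * u) = p * s * p - p * s * p * s * p\<close>, which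
  vanishes when \<open>u\<close> is idempotent. So \<open>s * p = p * s * p\<close> is self-adjoint.\<close>

lemma projections_commute:
  fixes p s :: "'a::cstar_algebra"
  assumes p: "p\<^sup>\<star> = p" "p * p = p" and s: "s\<^sup>\<star> = s" "s * s = s"
    and idem: "s * p * s * p = s * p"
  shows "s * p = p * s"
proof -
  have idem': "s * (p * (s * (p * z))) = s * (p * z)" "s * (p * (s * p)) = s * p" for z
    using idem by (metis mult.assoc)+
  have p': "p * (p * z) = p * z" and s': "s * (s * z) = s * z" for z
    using p s by (metis mult.assoc)+
  have "(s * p - p * s * p)\<^sup>\<star> * (s * p - p * s * p) = 0"
    by (simp add: adjoint_elt_diff adjoint_elt_mult p s p' s' idem' algebra_simps)
  then have eq: "s * p = p * s * p" using cstar_norm_eq_0 by force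
  have "p * s = (s * p)\<^sup>\<star>" by (simp add: adjoint_elt_mult p s)
  also have "\<dots> = (p * s * p)\<^sup>\<star>" using eq by simp
  also have "\<dots> = p * s * p" by (simp add: adjoint_elt_mult p s mult.assoc)
  finally show ?thesis using eq by simp
qed

section \<open>Existence and uniqueness of the Moore-Penrose inverse\<close>

text \<open>In \<open>(t * x - k * x)\<^sup>\<star> * (t * x - k * x)\<close> the mixed terms cancel, since \<open>k\<^sup>\<star> = - k\<close>.\<close>

lemma norm_skew_adjoint_shift:
  fixes k x :: "'a::cstar_algebra"
  assumes "k\<^sup>\<star> = - k"
  shows "(norm (t *\<^sub>R x - k * x))\<^sup>2 \<le> (t\<^sup>2 + (norm k)\<^sup>2) * (norm x)\<^sup>2"
proof -
  have "(t *\<^sub>R x - k * x)\<^sup>\<star> * (t *\<^sub>R x - k * x) = t\<^sup>2 *\<^sub>R (x\<^sup>\<star> * x) + (k * x)\<^sup>\<star> * (k * x)"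
    by (simp add: adjoint_elt_diff adjoint_elt_scaleR adjoint_elt_mult assms
        power2_eq_square algebra_simps)
  then have "(norm (t *\<^sub>R x - k * x))\<^sup>2
      \<le> norm (t\<^sup>2 *\<^sub>R (x\<^sup>\<star> * x)) + norm ((k * x)\<^sup>\<star> * (k * x))"
    by (metis cstar_identity norm_triangle_ineq)
  also have "\<dots> = t\<^sup>2 * (norm x)\<^sup>2 + (norm (k * x))\<^sup>2"
    by (simp add: cstar_identity)
  also have "(norm (k * x))\<^sup>2 \<le> (norm k)\<^sup>2 * (norm x)\<^sup>2"
    using power_mono[OF norm_mult_ineq[of k x], of 2] by (simp add: power_mult_distrib)
  finally show ?thesis by (simp add: algebra_simps)
qed

text \<open>This is the invertibility of \<open>1 + k\<close>, phrased so that it needs no unit.\<close>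

lemma skew_adjoint_unique_solution:
  fixes k y :: "'a::cstar_algebra"
  assumes k: "k\<^sup>\<star> = - k"
  shows "\<exists>!x. x + k * x = y"
proof -
  \<comment> \<open>Any \<open>t \<ge> 0\<close> with \<open>(norm k)\<^sup>2 < 1 + 2 * t\<close> makes the map below a contraction.\<close>
  define t where "t = (norm k)\<^sup>2"
  have t: "t \<ge> 0" by (simp add: t_def)
  define c where "c = sqrt (t\<^sup>2 + t) / (1 + t)"
  define T where "T = (\<lambda>x. (1 / (1 + t)) *\<^sub>R (y + (t *\<^sub>R x - k * x)))"
  have fix_iff: "T x = x \<longleftrightarrow> x + k * x = y" for x
  proof -
    have "T x = x \<longleftrightarrow> (1 + t) *\<^sub>R T x = (1 + t) *\<^sub>R x" using t by simp
    also have "(1 + t) *\<^sub>R T x = y + (t *\<^sub>R x - k * x)" using t by (simp add: T_def)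
    also have "\<dots> = (1 + t) *\<^sub>R x \<longleftrightarrow> x + k * x = y"
      by (auto simp: algebra_simps)
    finally show ?thesis .
  qed
  have "sqrt (t\<^sup>2 + t) < 1 + t"
    using t by (intro real_less_lsqrt) (auto simp: power2_eq_square algebra_simps)
  then have c: "0 \<le> c" "c < 1" using t by (auto simp: c_def)
  have contr: "dist (T u) (T v) \<le> c * dist u v" for u v
  proof -
    have "T u - T v = (1 / (1 + t)) *\<^sub>R (t *\<^sub>R (u - v) - k * (u - v))"
      by (simp add: T_def algebra_simps)
    then have *: "dist (T u) (T v) = norm (t *\<^sub>R (u - v) - k * (u - v)) / (1 + t)"
      using t by (simp add: dist_norm)
    have "norm (t *\<^sub>R (u - v) - k * (u - v)) \<le> sqrt ((t\<^sup>2 + t) * (norm (u - v))\<^sup>2)"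
      using norm_skew_adjoint_shift[OF k, of t "u - v"] unfolding t_def[symmetric]
      by (rule real_le_rsqrt)
    also have "\<dots> = sqrt (t\<^sup>2 + t) * norm (u - v)"
      by (simp add: real_sqrt_mult)
    finally show ?thesis
      unfolding * c_def using t by (simp add: dist_norm divide_right_mono)
  qed
  have "\<exists>!x. T x = x"
    using c contr by (intro banach_fix_type) auto
  then show ?thesis by (simp add: fix_iff)
qed

text \<open>With \<open>k = e\<^sup>\<star> - e\<close> the element \<open>f = (1 + k)\<^sup>-\<^sup>1 * e\<^sup>\<star>\<close> is self-adjoint because
  \<open>(1 + k) * f * (1 - k) = e\<^sup>\<star> * (1 - k) = e\<^sup>\<star> * e\<close> is, and \<open>1 - k\<close> is the adjoint of \<open>1 + k\<close>.\<close>

lemma idempotent_range_projection: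
  fixes e :: "'a::cstar_algebra"
  assumes e: "e * e = e"
  obtains f where "f\<^sup>\<star> = f" "e * f = f" "f * e = e"
proof -
  define k where "k = e\<^sup>\<star> - e"
  have k: "k\<^sup>\<star> = - k" by (simp add: k_def adjoint_elt_diff adjoint_elt_adjoint_elt)
  have e': "e\<^sup>\<star> * e\<^sup>\<star> = e\<^sup>\<star>" using e by (metis adjoint_elt_mult)
  note uniq = skew_adjoint_unique_solution[OF k]
  obtain f where f: "f + k * f = e\<^sup>\<star>" using uniq by blast
  have "f * e\<^sup>\<star> + k * (f * e\<^sup>\<star>) = e\<^sup>\<star>"
    using f e' by (metis distrib_right mult.assoc)
  then have fe': "f * e\<^sup>\<star> = f" using f uniq by blast
  have "0 + k * 0 = 0" by simp
  then have inj: "x = 0" if "x + k * x = 0" for x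
    using that uniq by blast
  have sandwich: "(f + k * f) - (f + k * f) * k = e\<^sup>\<star> * e"
    unfolding f by (simp add: k_def algebra_simps e')
  have "(f\<^sup>\<star> + k * f\<^sup>\<star>) - (f\<^sup>\<star> + k * f\<^sup>\<star>) * k = ((f + k * f) - (f + k * f) * k)\<^sup>\<star>"
    by (simp add: adjoint_elt_diff adjoint_elt_add adjoint_elt_mult k algebra_simps)
  also have "\<dots> = e\<^sup>\<star> * e"
    by (simp add: sandwich adjoint_elt_mult adjoint_elt_adjoint_elt)
  finally have sandwich': "(f\<^sup>\<star> + k * f\<^sup>\<star>) - (f\<^sup>\<star> + k * f\<^sup>\<star>) * k = e\<^sup>\<star> * e" .
  define X where "X = (f - f\<^sup>\<star>) + k * (f - f\<^sup>\<star>)"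
  have "X - X * k = ((f + k * f) - (f + k * f) * k)
      - ((f\<^sup>\<star> + k * f\<^sup>\<star>) - (f\<^sup>\<star> + k * f\<^sup>\<star>) * k)"
    by (simp add: X_def algebra_simps)
  then have "X - X * k = 0" unfolding sandwich sandwich' by simp
  then have "(X - X * k)\<^sup>\<star> = 0" by simp
  then have "X\<^sup>\<star> + k * X\<^sup>\<star> = 0"
    by (simp add: adjoint_elt_diff adjoint_elt_mult k)
  then have "X\<^sup>\<star> = 0" by (rule inj)
  then have "X = 0" by (metis adjoint_elt_adjoint_elt adjoint_elt_zero)
  then have "f - f\<^sup>\<star> = 0" unfolding X_def by (rule inj)
  then have sa: "f\<^sup>\<star> = f" by simp
  have ef: "e * f = f"
    using fe' sa by (metis adjoint_elt_mult adjoint_elt_adjoint_elt)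
  have "e\<^sup>\<star> * f = e\<^sup>\<star>"
    using f ef by (simp add: k_def algebra_simps)
  then have "f * e = e"
    using sa by (metis adjoint_elt_mult adjoint_elt_adjoint_elt)
  then show thesis using that sa ef by blast
qed

lemma regular_range_projection:
  fixes a :: "'a::cstar_algebra"
  assumes "regular_elt a"
  obtains f c where "f\<^sup>\<star> = f" "f * a = a" "f = a * c"
proof -
  obtain a' where a': "a = a * a' * a" using assms by (auto simp: regular_elt_def)
  then have "(a * a') * (a * a') = a * a'" by (metis mult.assoc)
  then obtain f where f: "f\<^sup>\<star> = f" "(a * a') * f = f" "f * (a * a') = a * a'"
    by (rule idempotent_range_projection)
  have "f * a = a" using f(3) a' by (metis mult.assoc)
  moreover have "f = a * (a' * f)" using f(2) by (simp add: mult.assoc)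
  ultimately show thesis using that f(1) by blast
qed

text \<open>If \<open>f\<close> and \<open>g\<close> are the projections for \<open>a\<close> and \<open>a\<^sup>\<star>\<close>, and \<open>a'\<close> is any inner inverse, then
  \<open>g * a' * f\<close> is the Moore-Penrose inverse, with \<open>a * (g * a' * f) = f\<close> and
  \<open>(g * a' * f) * a = g\<close>.\<close>

lemma regular_imp_mp_inverse:
  fixes a :: "'a::cstar_algebra"
  assumes "regular_elt a"
  shows "\<exists>x. is_mp_inverse a x"
proof -
  obtain a' where a': "a = a * a' * a" using assms by (auto simp: regular_elt_def)
  have "a\<^sup>\<star> = a\<^sup>\<star> * a'\<^sup>\<star> * a\<^sup>\<star>" using a' by (metis adjoint_elt_mult mult.assoc)
  then have "regular_elt (a\<^sup>\<star>)" by (auto simp: regular_elt_def)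
  then obtain g d where g: "g\<^sup>\<star> = g" "g * a\<^sup>\<star> = a\<^sup>\<star>" "g = a\<^sup>\<star> * d"
    by (rule regular_range_projection)
  obtain f c where f: "f\<^sup>\<star> = f" "f * a = a" "f = a * c"
    using assms by (rule regular_range_projection)
  have ag: "a * g = a" using g by (metis adjoint_elt_mult adjoint_elt_adjoint_elt)
  have gd: "g = d\<^sup>\<star> * a" using g by (metis adjoint_elt_mult adjoint_elt_adjoint_elt)
  define x where "x = g * a' * f"
  have ax: "a * x = f"
  proof -
    have "a * x = a * a' * a * c" unfolding x_def using ag f(3) by (metis mult.assoc)
    then show ?thesis using a' f(3) by simp
  qed
  have xa: "x * a = g"
  proof -
    have "x * a = d\<^sup>\<star> * (a * a' * a)" unfolding x_def using gd f(2) by (metis mult.assoc)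
    then show ?thesis using a' gd by simp
  qed
  have "g * g = g" using gd ag by (metis mult.assoc)
  then have "x * a * x = x" unfolding xa by (simp add: x_def mult.assoc[symmetric])
  then have "is_mp_inverse a x" using ax xa f(1,2) g(1) by (simp add: is_mp_inverse_def)
  then show ?thesis ..
qed

text \<open>For two Moore-Penrose inverses \<open>x\<close>, \<open>y\<close>, the products \<open>a * x\<close> and \<open>a * y\<close> are self-adjoint
  projections absorbing each other, hence equal; likewise \<open>x * a = y * a\<close>.\<close>

lemma is_mp_inverse_unique:
  assumes "is_mp_inverse a x" "is_mp_inverse a y"
  shows "x = y"
proof -
  note x = assms(1)[unfolded is_mp_inverse_def] and y = assms(2)[unfolded is_mp_inverse_def]
  have "a * x = (a * y) * (a * x)" using y by (metis mult.assoc)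
  also have "\<dots> = ((a * x) * (a * y))\<^sup>\<star>" using x y by (simp add: adjoint_elt_mult)
  also have "(a * x) * (a * y) = a * y" using x by (metis mult.assoc)
  finally have 1: "a * x = a * y" using y by simp
  have "x * a = (x * a) * (y * a)" using y by (metis mult.assoc)
  also have "\<dots> = ((y * a) * (x * a))\<^sup>\<star>" using x y by (simp add: adjoint_elt_mult)
  also have "(y * a) * (x * a) = y * a" using x by (metis mult.assoc)
  finally have 2: "x * a = y * a" using y by simp
  have "x = x * a * x" using x by simp
  also have "\<dots> = y * a * y" using 1 2 by (simp add: mult.assoc)
  finally show ?thesis using y by simp
qed

lemma mp_inverse_eqI: "is_mp_inverse a x \<Longrightarrow> a\<^sup>\<dagger> = x"
  unfolding mp_inverse_def using is_mp_inverse_unique by blast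

lemma mp_inverse_is_mp_inverse: "regular_elt a \<Longrightarrow> is_mp_inverse a (a\<^sup>\<dagger>)"
  using regular_imp_mp_inverse mp_inverse_eqI by metis

section \<open>The reverse order law\<close>

text \<open>These are oriented as rewrite rules for right-nested products; the versions with a trailing
  \<open>z\<close> apply inside a longer product.\<close>

lemma mp_inverse_rules:
  assumes "is_mp_inverse a x"
  shows "a * (x * a) = a" "x * (a * x) = x"
    and "x\<^sup>\<star> * a\<^sup>\<star> = a * x" "a\<^sup>\<star> * x\<^sup>\<star> = x * a"
    and "a * (x * x\<^sup>\<star>) = x\<^sup>\<star>" "x * (a * a\<^sup>\<star>) = a\<^sup>\<star>"
    and "x\<^sup>\<star> * (x * a) = x\<^sup>\<star>" "a\<^sup>\<star> * (a * x) = a\<^sup>\<star>"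
    and "a * (x * (a * z)) = a * z" "x * (a * (x * z)) = x * z"
    and "x\<^sup>\<star> * (a\<^sup>\<star> * z) = a * (x * z)" "a\<^sup>\<star> * (x\<^sup>\<star> * z) = x * (a * z)"
    and "a * (x * (x\<^sup>\<star> * z)) = x\<^sup>\<star> * z" "x * (a * (a\<^sup>\<star> * z)) = a\<^sup>\<star> * z"
    and "x\<^sup>\<star> * (x * (a * z)) = x\<^sup>\<star> * z" "a\<^sup>\<star> * (a * (x * z)) = a\<^sup>\<star> * z"
proof -
  have mp: "a = a * x * a" "x = x * a * x" "(a * x)\<^sup>\<star> = a * x" "(x * a)\<^sup>\<star> = x * a"
    using assms by (auto simp: is_mp_inverse_def)
  show 1: "a * (x * a) = a" "x * (a * x) = x"
    using mp(1,2) by (simp_all add: mult.assoc)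
  show 2: "x\<^sup>\<star> * a\<^sup>\<star> = a * x" "a\<^sup>\<star> * x\<^sup>\<star> = x * a"
    using mp(3,4) by (simp_all add: adjoint_elt_mult)
  show 3: "a * (x * x\<^sup>\<star>) = x\<^sup>\<star>"
    using adjoint_elt_mult[of x "a * x"] by (simp add: 1 mp(3) mult.assoc)
  show 4: "x * (a * a\<^sup>\<star>) = a\<^sup>\<star>"
    using adjoint_elt_mult[of a "x * a"] by (simp add: 1 mp(4) mult.assoc)
  show 5: "x\<^sup>\<star> * (x * a) = x\<^sup>\<star>"
    using adjoint_elt_mult[of "x * a" x] by (simp add: 1 mp(4) mult.assoc)
  show 6: "a\<^sup>\<star> * (a * x) = a\<^sup>\<star>"
    using adjoint_elt_mult[of "a * x" a] by (simp add: 1 mp(3) mult.assoc)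
  have extend: "u * (v * z) = w * z" if "u * v = w" for u v w
    using that by (simp add: mult.assoc[symmetric])
  have extend3: "u * (v * (w * z)) = t * z" if "u * (v * w) = t" for u v w t
    using extend[OF that] by (simp add: mult.assoc)
  show "a * (x * (a * z)) = a * z" "x * (a * (x * z)) = x * z"
    "a * (x * (x\<^sup>\<star> * z)) = x\<^sup>\<star> * z" "x * (a * (a\<^sup>\<star> * z)) = a\<^sup>\<star> * z"
    "x\<^sup>\<star> * (x * (a * z)) = x\<^sup>\<star> * z" "a\<^sup>\<star> * (a * (x * z)) = a\<^sup>\<star> * z"
    by (rule extend3, fact 1 3 4 5 6)+
  show "x\<^sup>\<star> * (a\<^sup>\<star> * z) = a * (x * z)" "a\<^sup>\<star> * (x\<^sup>\<star> * z) = x * (a * z)"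
    using extend[OF 2(1)] extend[OF 2(2)] by (simp_all add: mult.assoc)
qed

text \<open>Here \<open>x = a\<^sup>\<dagger>\<close> and \<open>y = b\<^sup>\<dagger>\<close>. In the forward direction the third and fourth Penrose
  equations for \<open>y * x\<close> give \<open>s * p * q = q * p * s\<close> and \<open>p * s * r = r * s * p\<close>. In the backward
  direction \<open>s * p * q * p = q * p\<close> says that \<open>p - p * s * p\<close> annihilates \<open>p * q * p\<close>, hence
  also \<open>p * s = p * q * p * (a\<^sup>\<star> * a)\<close>, which makes \<open>p * s\<close> idempotent.\<close>

lemma reverse_order_law_iff:
  fixes a b x y p q r s :: "'a::cstar_algebra"
  assumes x: "is_mp_inverse a x" and y: "is_mp_inverse b y"
    and p: "p = b * y" and q: "q = x * x\<^sup>\<star>" and r: "r = b * b\<^sup>\<star>" and s: "s = x * a"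
  shows "is_mp_inverse (a * b) (y * x) \<longleftrightarrow> s * p * q * p = q * p \<and> s * r * s * p = s * r"
proof -
  note X = mp_inverse_rules[OF x] and Y = mp_inverse_rules[OF y]
  have pa: "p\<^sup>\<star> = p" and sa: "s\<^sup>\<star> = s" using x y by (simp_all add: p s is_mp_inverse_def)
  have qa: "q\<^sup>\<star> = q" and ra: "r\<^sup>\<star> = r"
    by (simp_all add: q r adjoint_elt_mult adjoint_elt_adjoint_elt)
  have pp: "p * p = p" and ss: "s * s = s" by (simp_all add: p s X Y mult.assoc)
  have sq: "s * q = q" and qs: "q * s = q" and pr: "p * r = r" and rp: "r * p = r"
    by (simp_all add: p q r s X Y mult.assoc)
  show ?thesis
  proof
    assume mp: "is_mp_inverse (a * b) (y * x)"
    have "x * (a * b * (y * x) * (a * b)) * y = x * (a * b) * y"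
      using mp by (simp add: is_mp_inverse_def)
    then have "s * p * s * p = s * p" by (simp add: p s mult.assoc)
    then have comm: "s * p = p * s" using projections_commute pa pp sa ss by blast
    have "x * (a * b * (y * x)) * x\<^sup>\<star> = x * (a * b * (y * x))\<^sup>\<star> * x\<^sup>\<star>"
      using mp by (simp add: is_mp_inverse_def)
    moreover have "(a * b * (y * x))\<^sup>\<star> = x\<^sup>\<star> * p * a\<^sup>\<star>"
      using pa by (metis p adjoint_elt_mult mult.assoc)
    ultimately have spq: "s * p * q = q * p * s"
      by (simp add: p q s X mult.assoc)
    have "b * (y * x * (a * b)) * b\<^sup>\<star> = b * (y * x * (a * b))\<^sup>\<star> * b\<^sup>\<star>"
      using mp by (simp add: is_mp_inverse_def)
    moreover have "(y * x * (a * b))\<^sup>\<star> = b\<^sup>\<star> * s * y\<^sup>\<star>"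
      using sa by (metis s adjoint_elt_mult mult.assoc)
    ultimately have psr: "p * s * r = r * s * p"
      by (simp add: p r s Y mult.assoc)
    have "s * p * q * p = q * p" using spq comm qs pp by (metis mult.assoc)
    moreover have "s * r * s * p = s * r" using psr comm pr ss by (metis mult.assoc)
    ultimately show "s * p * q * p = q * p \<and> s * r * s * p = s * r" ..
  next
    assume iii: "s * p * q * p = q * p \<and> s * r * s * p = s * r"
    have ps_eq: "p * q * p * (a\<^sup>\<star> * a) = p * s"
    proof -
      have "a\<^sup>\<star> * a * (s * p * q * p) = a\<^sup>\<star> * a * (q * p)" using iii by simp
      then have "a\<^sup>\<star> * a * (p * q * p) = s * p" by (simp add: q s X mult.assoc)
      then have "(a\<^sup>\<star> * a * (p * q * p))\<^sup>\<star> = (s * p)\<^sup>\<star>" by simp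
      then show ?thesis
        by (simp add: adjoint_elt_mult adjoint_elt_adjoint_elt pa qa sa mult.assoc)
    qed
    have "p * s * (p * q * p) = p * q * p" using iii by (metis mult.assoc)
    then have "p * s * p * s = p * s" using ps_eq by (metis mult.assoc)
    then have comm: "p * s = s * p" using projections_commute[OF sa ss pa pp] by blast
    have "q * p = p * q * p" using iii comm sq by (metis mult.assoc)
    then have pq: "p * q = q * p" using pa qa by (metis adjoint_elt_mult mult.assoc)
    have "s * r = s * r * s"
    proof -
      have "s * r * s * p = s * r * p * s" using comm by (simp add: mult.assoc)
      then show ?thesis using iii rp by (simp add: mult.assoc)
    qed
    then have rs: "r * s = s * r" using ra sa by (metis adjoint_elt_mult mult.assoc)
    have "a * b * (y * x) * (a * b) = a * b"
    proof -
      have "a * b * (y * x) * (a * b) = a * (p * s) * b" by (simp add: p s mult.assoc)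
      also have "\<dots> = a * b" unfolding comm by (simp add: p s X Y mult.assoc)
      finally show ?thesis .
    qed
    moreover have "y * x * (a * b) * (y * x) = y * x"
    proof -
      have "y * x * (a * b) * (y * x) = y * (s * p) * x" by (simp add: p s mult.assoc)
      also have "\<dots> = y * x" unfolding comm[symmetric] by (simp add: p s X Y mult.assoc)
      finally show ?thesis .
    qed
    moreover have "(a * b * (y * x))\<^sup>\<star> = a * b * (y * x)"
    proof -
      have "a * b * (y * x) = a * (p * q) * a\<^sup>\<star>" by (simp add: p q X mult.assoc)
      moreover have "(a * (p * q) * a\<^sup>\<star>)\<^sup>\<star> = a * (p * q) * a\<^sup>\<star>"
        using pq pa qa by (simp add: adjoint_elt_mult adjoint_elt_adjoint_elt mult.assoc)
      ultimately show ?thesis by simp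
    qed
    moreover have "(y * x * (a * b))\<^sup>\<star> = y * x * (a * b)"
    proof -
      have "y * x * (a * b) = y * (s * r) * y\<^sup>\<star>" by (simp add: r s Y mult.assoc)
      moreover have "(y * (s * r) * y\<^sup>\<star>)\<^sup>\<star> = y * (s * r) * y\<^sup>\<star>"
        using rs sa ra by (simp add: adjoint_elt_mult adjoint_elt_adjoint_elt mult.assoc)
      ultimately show ?thesis by simp
    qed
    ultimately show "is_mp_inverse (a * b) (y * x)" by (simp add: is_mp_inverse_def)
  qed
qed

text \<open>Since \<open>x * a = s\<close> and \<open>b * y = p\<close>, the factors \<open>a\<close> and \<open>y\<^sup>\<star>\<close> around an element can be
  exchanged for \<open>s\<close> and \<open>p\<close>.\<close>

lemma sandwich_eq_0_iff:
  fixes a b x y z :: "'a::cstar_algebra"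
  assumes x: "is_mp_inverse a x" and y: "is_mp_inverse b y"
  shows "a * z * y\<^sup>\<star> = 0 \<longleftrightarrow> (x * a) * z * (b * y) = 0"
proof -
  note X = mp_inverse_rules[OF x] and Y = mp_inverse_rules[OF y]
  have "(x * a) * z * (b * y) = x * (a * z * y\<^sup>\<star>) * b\<^sup>\<star>"
    by (simp add: Y mult.assoc)
  moreover have "a * z * y\<^sup>\<star> = a * ((x * a) * z * (b * y)) * y\<^sup>\<star>"
    by (simp add: X Y mult.assoc)
  ultimately show ?thesis by (metis mult_zero_left mult_zero_right)
qed

theorem theorem3p1:
  fixes a b p q r s :: "'a::cstar_algebra"
  assumes "regular_elt a" and "regular_elt b" and "regular_elt (a * b)"
    and "p = b * b\<^sup>\<dagger>"
    and "q = a\<^sup>\<dagger> * (a\<^sup>\<dagger>)\<^sup>\<star>"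
    and "r = b * b\<^sup>\<star>"
    and "s = a\<^sup>\<dagger> * a"
  shows "((a * b)\<^sup>\<dagger> = b\<^sup>\<dagger> * a\<^sup>\<dagger> \<longleftrightarrow>
      a * (p * q - q * p) * (b\<^sup>\<dagger>)\<^sup>\<star> = 0 \<and> a * (r * s - s * r) * (b\<^sup>\<dagger>)\<^sup>\<star> = 0) \<and>
    (a * (p * q - q * p) * (b\<^sup>\<dagger>)\<^sup>\<star> = 0 \<and> a * (r * s - s * r) * (b\<^sup>\<dagger>)\<^sup>\<star> = 0 \<longleftrightarrow>
      s * p * q * p = q * p \<and> s * r * s * p = s * r)"
proof -
  have x: "is_mp_inverse a (a\<^sup>\<dagger>)" and y: "is_mp_inverse b (b\<^sup>\<dagger>)"
    using assms(1,2) by (auto intro: mp_inverse_is_mp_inverse)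
  note X = mp_inverse_rules[OF x] and Y = mp_inverse_rules[OF y]
  have i: "(a * b)\<^sup>\<dagger> = b\<^sup>\<dagger> * a\<^sup>\<dagger> \<longleftrightarrow> is_mp_inverse (a * b) (b\<^sup>\<dagger> * a\<^sup>\<dagger>)"
    using mp_inverse_is_mp_inverse[OF assms(3)] mp_inverse_eqI by metis
  have "s * (p * q - q * p) * p = s * p * q * p - q * p"
    by (simp add: assms(4,5,7) X Y mult.assoc left_diff_distrib right_diff_distrib)
  then have ii1: "a * (p * q - q * p) * (b\<^sup>\<dagger>)\<^sup>\<star> = 0 \<longleftrightarrow> s * p * q * p = q * p"
    using sandwich_eq_0_iff[OF x y, of "p * q - q * p"] by (simp add: assms(4,7))
  have "s * (r * s - s * r) * p = s * r * s * p - s * r"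
    by (simp add: assms(4,6,7) X Y mult.assoc left_diff_distrib right_diff_distrib)
  then have ii2: "a * (r * s - s * r) * (b\<^sup>\<dagger>)\<^sup>\<star> = 0 \<longleftrightarrow> s * r * s * p = s * r"
    using sandwich_eq_0_iff[OF x y, of "r * s - s * r"] by (simp add: assms(4,7))
  show ?thesis
    unfolding i ii1 ii2 using reverse_order_law_iff[OF x y assms(4-7)] by blast
qed

end
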